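(* Let $x\in\mathbb{R}$, let $b\in\mathbb{R}$ be a fixed barrier, and let $X$, $Y$ be spectrally negative Lévy processes and $N$ a Poisson process of rate $\lambda\in(0,\infty)$ with $X,Y,N$ independent. For $U_0=x$ there exists a strong solution $U=\{U_t\}_{t\ge 0}$ to the (hybrid) stochastic differential equation $$U_t = U_0 + \int_0^t \mathbf{1}_{\{U_{T_{N(s)}} \le b\}}\, \mathrm{d}X_s + \int_0^t \mathbf{1}_{\{U_{T_{N(s)}} > b\}}\, \mathrm{d}Y_s,\qquad t\ge 0,$$ where $T_0=0$ and $T_1<T_2<\cdots$ are the arrival times of $N$.
   Context: A spectrally negative Lévy process (SNLP) is a real-valued Lévy process with no positive jumps and non-monotone paths (bounded or unbounded variation is allowed). $X$, $Y$ and $N$ are defined on a filtered probability space $(\Omega,\mathcal{F},\{\mathcal{F}_t\}_{t\ge0},\mathbb{P})$ satisfying the usual conditions and are adapted to it. $X$ and $Y$ may have different Laplace exponents, and only their increments enter the equation. The Poisson process $N$ has arrival times $T_0=0$, $T_i=\sum_{k=1}^{i}\xi_k$ with $\{\xi_k\}_{k\ge1}$ i.i.d. exponential random variables with parameter $\lambda<\infty$, so $T_{N(s)}$ is the last arrival time not later than $s$. The integrands are constant on each interval $[T_i,T_{i+1})$, and the integrals are understood pathwise as the corresponding sums of increments of $X$ (respectively $Y$) over such intervals. A strong solution is a càdlàg adapted process constructed on the given probability space from the given driving processes $X,Y,N$ and satisfying the equation almost surely. *)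

theory Defs
  imports "HOL-Probability.Probability"
begin

section \<open>Processes and filtrations\<close>

text \<open>Processes are indexed by the reals, but only their values at times \<open>t \<ge> 0\<close> are ever used.\<close>

definition cadlag :: "(real \<Rightarrow> real) \<Rightarrow> bool" where
  "cadlag f \<longleftrightarrow>
     (\<forall>t\<ge>0. continuous (at_right t) f) \<and> (\<forall>t>0. \<exists>l. (f \<longlongrightarrow> l) (at_left t))"

definition adapted :: "(real \<Rightarrow> 'a measure) \<Rightarrow> 'b measure \<Rightarrow> (real \<Rightarrow> 'a \<Rightarrow> 'b) \<Rightarrow> bool" where
  "adapted F S Z \<longleftrightarrow> (\<forall>t\<ge>0. Z t \<in> measurable (F t) S)"

text \<open>\<open>F 0\<close> contains the null events of \<open>M\<close>. If \<open>M\<close> is complete, these are all negligible sets;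
  completeness of \<open>M\<close> itself is not imposed.\<close>

definition usual_conditions :: "'a measure \<Rightarrow> (real \<Rightarrow> 'a measure) \<Rightarrow> bool" where
  "usual_conditions M F \<longleftrightarrow>
     null_sets M \<subseteq> sets (F 0) \<and> (\<forall>t\<ge>0. (\<Inter>s\<in>{t<..}. sets (F s)) = sets (F t))"

definition filtered_prob_space :: "'a measure \<Rightarrow> (real \<Rightarrow> 'a measure) \<Rightarrow> bool" where
  "filtered_prob_space M F \<longleftrightarrow>
     prob_space M \<and> filtration (space M) F \<and> (\<forall>t\<ge>0. subalgebra M (F t)) \<and> usual_conditions M F"

definition path_events ::
  "'a measure \<Rightarrow> 'b measure \<Rightarrow> (real \<Rightarrow> 'a \<Rightarrow> 'b) \<Rightarrow> real set \<Rightarrow> 'a set set" where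
  "path_events M S Z I = (\<Union>t\<in>I. {Z t -` A \<inter> space M | A. A \<in> sets S})"

section \<open>The driving processes\<close>

definition levy_process :: "'a measure \<Rightarrow> (real \<Rightarrow> 'a \<Rightarrow> real) \<Rightarrow> bool" where
  "levy_process M X \<longleftrightarrow>
     (\<forall>t\<ge>0. X t \<in> borel_measurable M) \<and>
     (AE \<omega> in M. cadlag (\<lambda>t. X t \<omega>)) \<and>
     (AE \<omega> in M. X 0 \<omega> = 0) \<and>
     (\<forall>n (\<tau> :: nat \<Rightarrow> real). 0 \<le> \<tau> 0 \<and> mono \<tau> \<longrightarrow>
        prob_space.indep_vars M (\<lambda>_. borel) (\<lambda>i \<omega>. X (\<tau> (Suc i)) \<omega> - X (\<tau> i) \<omega>) {..<n}) \<and>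
     (\<forall>s t. 0 \<le> s \<and> s \<le> t \<longrightarrow>
        distr M borel (\<lambda>\<omega>. X t \<omega> - X s \<omega>) = distr M borel (X (t - s)))"

definition spectrally_negative_levy :: "'a measure \<Rightarrow> (real \<Rightarrow> 'a \<Rightarrow> real) \<Rightarrow> bool" where
  "spectrally_negative_levy M X \<longleftrightarrow>
     levy_process M X \<and>
     (AE \<omega> in M. \<forall>t>0. X t \<omega> \<le> Lim (at_left t) (\<lambda>s. X s \<omega>)) \<and>
     (AE \<omega> in M. \<not> mono_on {0..} (\<lambda>t. X t \<omega>) \<and> \<not> antimono_on {0..} (\<lambda>t. X t \<omega>))"

definition arrival_time :: "(nat \<Rightarrow> 'a \<Rightarrow> real) \<Rightarrow> nat \<Rightarrow> 'a \<Rightarrow> real" where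
  "arrival_time \<xi> i \<omega> = (\<Sum>k=1..i. \<xi> k \<omega>)"

definition poisson_process ::
  "'a measure \<Rightarrow> real \<Rightarrow> (nat \<Rightarrow> 'a \<Rightarrow> real) \<Rightarrow> (real \<Rightarrow> 'a \<Rightarrow> nat) \<Rightarrow> bool" where
  "poisson_process M rate \<xi> N \<longleftrightarrow>
     prob_space.indep_vars M (\<lambda>_. borel) \<xi> {1..} \<and>
     (\<forall>k\<ge>1. distributed M lborel (\<xi> k) (exponential_density rate)) \<and>
     (AE \<omega> in M. \<forall>t\<ge>0. N t \<omega> = card {i. 1 \<le> i \<and> arrival_time \<xi> i \<omega> \<le> t})"

definition independent_drivers ::
  "'a measure \<Rightarrow> (real \<Rightarrow> 'a \<Rightarrow> real) \<Rightarrow> (real \<Rightarrow> 'a \<Rightarrow> real) \<Rightarrow> (real \<Rightarrow> 'a \<Rightarrow> nat) \<Rightarrow> bool" where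
  "independent_drivers M X Y N \<longleftrightarrow>
     prob_space.indep_sets M
       (nth [sigma_sets (space M) (path_events M borel X {0..}),
             sigma_sets (space M) (path_events M borel Y {0..}),
             sigma_sets (space M) (path_events M (count_space UNIV) N {0..})]) {..<3}"

text \<open>The filtration generated by the driving processes, augmented by the null events.\<close>

definition driving_filtration ::
  "'a measure \<Rightarrow> (real \<Rightarrow> 'a \<Rightarrow> real) \<Rightarrow> (real \<Rightarrow> 'a \<Rightarrow> real) \<Rightarrow> (real \<Rightarrow> 'a \<Rightarrow> nat) \<Rightarrow> real \<Rightarrow> 'a measure"
  where
  "driving_filtration M X Y N t =
     sigma (space M)
       (path_events M borel X {0..t} \<union> path_events M borel Y {0..t} \<union>
        path_events M (count_space UNIV) N {0..t} \<union> null_sets M)"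

section \<open>The hybrid equation\<close>

text \<open>The pathwise integral \<open>\<integral>\<^sub>0\<^sup>t H s dZ s\<close> of an integrand that is constant on each
  \<open>[T i, T (Suc i))\<close>, as a sum of increments of \<open>Z\<close>. The increment over the \<open>i\<close>-th interval,
  cut off at \<open>t\<close>, is \<open>Z (min t (T (Suc i))) - Z (T i)\<close>: a jump of \<open>Z\<close> at an arrival time would be
  attributed to the preceding interval, but almost surely there is none when \<open>Z\<close> is a Levy process
  independent of the arrival times.\<close>

definition step_integral ::
  "(nat \<Rightarrow> real) \<Rightarrow> (real \<Rightarrow> real) \<Rightarrow> (real \<Rightarrow> real) \<Rightarrow> real \<Rightarrow> real" where
  "step_integral T H Z t =
     (\<Sum>i | T i \<le> t. H (T i) * (Z (min t (T (Suc i))) - Z (T i)))"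

definition hybrid_equation ::
  "real \<Rightarrow> (nat \<Rightarrow> real) \<Rightarrow> (real \<Rightarrow> nat) \<Rightarrow> (real \<Rightarrow> real) \<Rightarrow> (real \<Rightarrow> real) \<Rightarrow> (real \<Rightarrow> real) \<Rightarrow> bool"
  where
  "hybrid_equation b T N X Y U \<longleftrightarrow>
     (\<forall>t\<ge>0. U t = U 0
        + step_integral T (\<lambda>s. indicator {..b} (U (T (N s)))) X t
        + step_integral T (\<lambda>s. indicator {b<..} (U (T (N s)))) Y t)"

text \<open>Besides being adapted to the given filtration, a strong solution has to be a functional of the
  driving processes: \<open>U t\<close> is determined, up to null events, by their paths on \<open>[0, t]\<close>.\<close>

definition strong_solution ::
  "'a measure \<Rightarrow> (real \<Rightarrow> 'a measure) \<Rightarrow> real \<Rightarrow> (nat \<Rightarrow> 'a \<Rightarrow> real) \<Rightarrow> (real \<Rightarrow> 'a \<Rightarrow> nat) \<Rightarrow>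
   (real \<Rightarrow> 'a \<Rightarrow> real) \<Rightarrow> (real \<Rightarrow> 'a \<Rightarrow> real) \<Rightarrow> real \<Rightarrow> (real \<Rightarrow> 'a \<Rightarrow> real) \<Rightarrow> bool" where
  "strong_solution M F b \<xi> N X Y x U \<longleftrightarrow>
     (\<forall>\<omega>\<in>space M. cadlag (\<lambda>t. U t \<omega>)) \<and>
     adapted F borel U \<and>
     adapted (driving_filtration M X Y N) borel U \<and>
     (AE \<omega> in M. U 0 \<omega> = x) \<and>
     (AE \<omega> in M. hybrid_equation b (\<lambda>i. arrival_time \<xi> i \<omega>) (\<lambda>t. N t \<omega>)
        (\<lambda>t. X t \<omega>) (\<lambda>t. Y t \<omega>) (\<lambda>t. U t \<omega>))"

end

theory Submission
  imports Defs
begin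

text \<open>
  Between consecutive arrival times the equation prescribes the increments of the solution, so it is
  solved pathwise by recursion over the arrival times. For adaptedness the recursion is stopped at
  the current time \<open>t\<close>: it then only involves \<open>min t (T i)\<close>, which is determined by \<open>N\<close> on
  \<open>[0, t]\<close>, and the values of \<open>X\<close> and \<open>Y\<close> at these random times, which are limits of values at
  discretised times by right continuity. On the null event where the paths misbehave the
  drivers are replaced by deterministic ones.
\<close>

section \<open>Cadlag functions\<close>

lemma cadlag_const: "cadlag (\<lambda>_. c)"
  by (auto simp: cadlag_def intro!: exI[of _ c])

lemma cadlag_right: "cadlag f \<Longrightarrow> 0 \<le> t \<Longrightarrow> (f \<longlongrightarrow> f t) (at_right t)"
  by (auto simp: cadlag_def continuous_within)

lemma cadlag_add:
  assumes "cadlag f" "cadlag g"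
  shows "cadlag (\<lambda>t. f t + g t)"
  unfolding cadlag_def
proof (intro conjI allI impI)
  fix t :: real assume "t \<ge> 0"
  then show "continuous (at_right t) (\<lambda>t. f t + g t)"
    using assms by (auto simp: cadlag_def intro!: continuous_add)
next
  fix t :: real assume "t > 0"
  with assms obtain l m where "(f \<longlongrightarrow> l) (at_left t)" "(g \<longlongrightarrow> m) (at_left t)"
    unfolding cadlag_def by blast
  then show "\<exists>l. ((\<lambda>t. f t + g t) \<longlongrightarrow> l) (at_left t)"
    by (blast intro: tendsto_add)
qed

lemma cadlag_minus:
  assumes "cadlag f"
  shows "cadlag (\<lambda>t. - f t)"
  using assms by (fastforce simp: cadlag_def intro: continuous_minus tendsto_minus)

lemma cadlag_diff: "cadlag f \<Longrightarrow> cadlag g \<Longrightarrow> cadlag (\<lambda>t. f t - g t)"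
  using cadlag_add[OF _ cadlag_minus, of f g] by simp

text \<open>Near a time before \<open>c\<close> the stopped path is \<open>f\<close> itself, and
  from \<open>c\<close> on it is constant. For left limits the case \<open>t = c\<close> belongs to
  the first kind, since only times below \<open>t\<close> count.\<close>

lemma cadlag_stopped:
  assumes f: "cadlag f"
  shows "cadlag (\<lambda>t. f (min t c))"
  unfolding cadlag_def continuous_within
proof (intro conjI allI impI)
  fix t :: real assume t: "t \<ge> 0"
  show "((\<lambda>t. f (min t c)) \<longlongrightarrow> f (min t c)) (at_right t)"
  proof (cases "t < c")
    case True
    then have "eventually (\<lambda>s. f s = f (min s c)) (at_right t)"
      by (auto simp: eventually_at_right_field intro!: exI[of _ c])
    with True cadlag_right[OF f t] show ?thesis
      by (auto intro: Lim_transform_eventually)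
  next
    case False
    then have "eventually (\<lambda>s. f c = f (min s c)) (at_right t)"
      by (auto simp: eventually_at_right_field min_def intro!: exI[of _ "t + 1"])
    with False show ?thesis
      by (auto intro: Lim_transform_eventually tendsto_const simp: min_def)
  qed
next
  fix t :: real assume t: "t > 0"
  show "\<exists>l. ((\<lambda>t. f (min t c)) \<longlongrightarrow> l) (at_left t)"
  proof (cases "t \<le> c")
    case True
    from f t obtain l where "(f \<longlongrightarrow> l) (at_left t)"
      by (auto simp: cadlag_def)
    moreover from True have "eventually (\<lambda>s. f s = f (min s c)) (at_left t)"
      by (auto simp: eventually_at_left_field intro!: exI[of _ "t - 1"])
    ultimately show ?thesis
      by (blast intro: Lim_transform_eventually)
  next
    case False
    then have "eventually (\<lambda>s. f c = f (min s c)) (at_left t)"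
      by (auto simp: eventually_at_left_field intro!: exI[of _ c])
    then show ?thesis
      by (blast intro: Lim_transform_eventually tendsto_const)
  qed
qed

text \<open>One-sided limits at \<open>t\<close> depend only on values near \<open>t\<close>. This
  lets a path be checked through simpler paths that agree with it up to some time beyond
  \<open>t\<close>, without gluing at the arrival times.\<close>

lemma cadlag_local:
  assumes "\<And>t. 0 \<le> t \<Longrightarrow> \<exists>g r. cadlag g \<and> t < r \<and> (\<forall>s. 0 \<le> s \<and> s < r \<longrightarrow> g s = f s)"
  shows "cadlag f"
  unfolding cadlag_def continuous_within
proof (intro conjI allI impI)
  fix t :: real assume t: "t \<ge> 0"
  with assms obtain g r where g: "cadlag g" "t < r" "\<forall>s. 0 \<le> s \<and> s < r \<longrightarrow> g s = f s"
    by blast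
  have "eventually (\<lambda>s. g s = f s) (at_right t)"
    using g t by (auto simp: eventually_at_right_field intro!: exI[of _ r])
  with cadlag_right[OF g(1) t] g t show "(f \<longlongrightarrow> f t) (at_right t)"
    by (auto intro: Lim_transform_eventually)
next
  fix t :: real assume t: "t > 0"
  with assms[of t] obtain g r where g: "cadlag g" "t < r" "\<forall>s. 0 \<le> s \<and> s < r \<longrightarrow> g s = f s"
    by auto
  have "eventually (\<lambda>s. g s = f s) (at_left t)"
    using g t by (auto simp: eventually_at_left_field intro!: exI[of _ 0])
  moreover from g t obtain l where "(g \<longlongrightarrow> l) (at_left t)"
    by (auto simp: cadlag_def)
  ultimately show "\<exists>l. (f \<longlongrightarrow> l) (at_left t)"
    by (blast intro: Lim_transform_eventually)
qed

section \<open>The pathwise solution\<close>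

text \<open>Stage \<open>i\<close> is the solution stopped at \<open>T i\<close>. The regime is
  tested at time \<open>t\<close> instead of \<open>T i\<close>, so that nothing after
  \<open>t\<close> enters: for \<open>T i \<le> t\<close> the two tests agree, and for
  \<open>t < T i\<close> both increments vanish when \<open>T\<close> is increasing.\<close>

fun hybrid_rec ::
  "real \<Rightarrow> real \<Rightarrow> (nat \<Rightarrow> real) \<Rightarrow> (real \<Rightarrow> real) \<Rightarrow> (real \<Rightarrow> real) \<Rightarrow> nat \<Rightarrow> real \<Rightarrow> real" where
  "hybrid_rec b x T X Y 0 t = x"
| "hybrid_rec b x T X Y (Suc i) t = hybrid_rec b x T X Y i t +
     (if hybrid_rec b x T X Y i t \<le> b then X (min t (T (Suc i))) - X (min t (T i))
      else Y (min t (T (Suc i))) - Y (min t (T i)))"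

text \<open>\<open>T_le_iff\<close> says that \<open>N\<close> counts the arrivals after
  \<open>T 0\<close>. As \<open>N t\<close> is finite, it also forces \<open>T\<close> to be
  unbounded.\<close>

locale hybrid_paths =
  fixes T :: "nat \<Rightarrow> real" and N :: "real \<Rightarrow> nat" and X Y :: "real \<Rightarrow> real" and b x :: real
  assumes T_0: "T 0 = 0"
    and T_strict: "strict_mono T"
    and T_le_iff: "0 \<le> t \<Longrightarrow> T i \<le> t \<longleftrightarrow> i \<le> N t"
    and cadlag_X: "cadlag X"
    and cadlag_Y: "cadlag Y"
begin

abbreviation V where "V \<equiv> hybrid_rec b x T X Y"

text \<open>At time \<open>t\<close> the interval that starts at \<open>T (N t)\<close> is in
  progress, so its increment has to be included; stage \<open>N t\<close> would already be stopped
  at \<open>T (N t)\<close>.\<close>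

definition U where "U t = V (Suc (N t)) t"

lemma T_nonneg: "0 \<le> T i"
  using strict_mono_mono[OF T_strict] T_0 by (metis monoD zero_le)

lemma N_T: "N (T i) = i"
proof (rule antisym)
  show "N (T i) \<le> i"
    using T_le_iff[OF T_nonneg, of "N (T i)" i] strict_mono_less_eq[OF T_strict] by simp
  show "i \<le> N (T i)"
    using T_le_iff[OF T_nonneg, of i i] by simp
qed

lemma V_Suc_stopped: "t \<le> T i \<Longrightarrow> V (Suc i) t = V i t"
  using strict_monoD[OF T_strict, of i "Suc i"] by (simp add: min_absorb1)

text \<open>Every stage after \<open>m\<close> adds an increment over an interval that starts no
  earlier than \<open>t\<close>, and cutting it off at \<open>t\<close> makes it zero.\<close>

lemma V_stopped:
  assumes "t \<le> T m" "m \<le> n"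
  shows "V n t = V m t"
  using assms(2)
proof (induction n rule: dec_induct)
  case (step n)
  have "t \<le> T n"
    using assms(1) step(1) strict_mono_less_eq[OF T_strict, of m n] by simp
  from V_Suc_stopped[OF this] step show ?case by simp
qed simp

text \<open>Once \<open>t\<close> has passed \<open>T i\<close>, all cut-offs in the first
  \<open>i\<close> stages are arrival times, and by induction the regime tests no longer depend on
  \<open>t\<close>.\<close>

lemma V_frozen: "T i \<le> t \<Longrightarrow> V i t = V i (T i)"
proof (induction i arbitrary: t)
  case (Suc i)
  have "T i < T (Suc i)" using T_strict by (simp add: strict_mono_less)
  with Suc.IH[of t] Suc.IH[of "T (Suc i)"] Suc.prems show ?case
    by (simp add: min_absorb2)
qed simp

text \<open>Here the regime is decided by a number independent of \<open>t\<close>. As a function of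
  \<open>t\<close>, each stage is thus a sum of stopped driver increments, from which both its path
  regularity and the equation follow.\<close>

lemma V_Suc:
  "V (Suc i) t = V i t +
     (if V i (T i) \<le> b then X (min t (T (Suc i))) - X (min t (T i))
      else Y (min t (T (Suc i))) - Y (min t (T i)))"
proof (cases "T i \<le> t")
  case True
  show ?thesis by (simp only: hybrid_rec.simps V_frozen[OF True])
next
  case False
  then show ?thesis
    using V_Suc_stopped[of t i] strict_monoD[OF T_strict, of i "Suc i"] by (simp add: min_absorb1)
qed

lemma cadlag_V: "cadlag (V i)"
proof (induction i)
  case 0
  then show ?case by (simp add: cadlag_const)
next
  case (Suc i)
  have "V (Suc i) = (\<lambda>t. V i t +
     (if V i (T i) \<le> b then X (min t (T (Suc i))) - X (min t (T i))
      else Y (min t (T (Suc i))) - Y (min t (T i))))"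
    by (rule ext, rule V_Suc)
  moreover have "cadlag \<dots>"
    using Suc cadlag_X cadlag_Y
    by (cases "V i (T i) \<le> b") (auto intro!: cadlag_add cadlag_diff cadlag_stopped)
  ultimately show ?case by simp
qed

lemma T_le: "0 \<le> t \<Longrightarrow> T (N t) \<le> t"
  by (simp add: T_le_iff)

lemma T_Suc_gt: "0 \<le> t \<Longrightarrow> t < T (Suc (N t))"
  using T_le_iff[of t "Suc (N t)"] by simp

lemma cadlag_U: "cadlag U"
proof (rule cadlag_local)
  fix t :: real assume t: "0 \<le> t"
  let ?n = "Suc (N t)"
  \<comment> \<open>The single stage \<open>?n\<close> represents \<open>U\<close> on all of
    \<open>[0, T ?n)\<close>, because later stages change nothing at earlier times.\<close>
  have "V ?n s = U s" if "0 \<le> s" "s < T ?n" for s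
  proof -
    have "N s < ?n" using that T_le_iff[of s ?n] by simp
    then show ?thesis
      using V_stopped[of s "Suc (N s)" ?n] T_Suc_gt[OF that(1)] by (simp add: U_def)
  qed
  then show "\<exists>g r. cadlag g \<and> t < r \<and> (\<forall>s. 0 \<le> s \<and> s < r \<longrightarrow> g s = U s)"
    using cadlag_V T_Suc_gt[OF t] by blast
qed

text \<open>At its own starting time the interval of index \<open>i\<close> has contributed nothing
  yet. So the regime that the equation reads off from \<open>U\<close> is the one tested in the
  recursion.\<close>

lemma U_T: "U (T i) = V i (T i)"
  using V_Suc_stopped[of "T i" i] by (simp add: U_def N_T)

lemma U_0: "U 0 = x"
  using U_T[of 0] by (simp add: T_0)

lemma hybrid_equation_U: "hybrid_equation b T N X Y U"
  unfolding hybrid_equation_def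
proof (intro allI impI)
  fix t :: real assume t: "t \<ge> 0"
  \<comment> \<open>The recursion is unrolled up to the interval containing \<open>t\<close>. The
    bound on \<open>n\<close> gives \<open>T i \<le> t\<close> for each summand, so the lower
    cut-off is \<open>T i\<close>; exactly one of the two indicators is 1.\<close>
  have *: "V n t = x + (\<Sum>i<n. indicator {..b} (U (T (N (T i)))) * (X (min t (T (Suc i))) - X (T i)))
      + (\<Sum>i<n. indicator {b<..} (U (T (N (T i)))) * (Y (min t (T (Suc i))) - Y (T i)))"
    if "n \<le> Suc (N t)" for n
    using that
  proof (induction n)
    case (Suc n)
    then have "T n \<le> t" using T_le_iff[OF t] by simp
    then have "V (Suc n) t = V n t
        + indicator {..b} (U (T (N (T n)))) * (X (min t (T (Suc n))) - X (T n))
        + indicator {b<..} (U (T (N (T n)))) * (Y (min t (T (Suc n))) - Y (T n))"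
      unfolding V_Suc by (simp add: N_T U_T min_absorb2 indicator_def)
    moreover from Suc.prems have "n \<le> Suc (N t)" by simp
    note Suc.IH[OF this]
    ultimately show ?case
      by (simp only: sum.lessThan_Suc add_ac)
  qed simp
  have "{i. T i \<le> t} = {..<Suc (N t)}"
    by (simp add: T_le_iff[OF t] less_Suc_eq_le lessThan_def)
  with *[OF order_refl] U_def[of t] show "U t = U 0
        + step_integral T (\<lambda>s. indicator {..b} (U (T (N s)))) X t
        + step_integral T (\<lambda>s. indicator {b<..} (U (T (N s)))) Y t"
    by (simp only: step_integral_def U_0)
qed

end

section \<open>Measurability\<close>

text \<open>The random time is approximated from the right by times with countably many values,
  where measurability is clear; right continuity of the paths passes it to the limit.\<close>

lemma measurable_at_random_time:
  fixes Z :: "real \<Rightarrow> 'a \<Rightarrow> real" and \<tau> :: "'a \<Rightarrow> real"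
  assumes Z: "\<And>s. 0 \<le> s \<Longrightarrow> s \<le> t \<Longrightarrow> Z s \<in> borel_measurable G"
    and right: "\<And>\<omega> s. \<omega> \<in> space G \<Longrightarrow> 0 \<le> s \<Longrightarrow> ((\<lambda>s. Z s \<omega>) \<longlongrightarrow> Z s \<omega>) (at_right s)"
    and \<tau>: "\<tau> \<in> borel_measurable G" "\<And>\<omega>. \<omega> \<in> space G \<Longrightarrow> 0 \<le> \<tau> \<omega>" "\<And>\<omega>. \<omega> \<in> space G \<Longrightarrow> \<tau> \<omega> \<le> t"
    and t: "0 \<le> t"
  shows "(\<lambda>\<omega>. Z (\<tau> \<omega>) \<omega>) \<in> borel_measurable G"
proof (rule borel_measurable_LIMSEQ_real)
  \<comment> \<open>\<open>p n k\<close> is the right end of the \<open>k\<close>-th cell of a grid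
    of mesh \<open>1 / (n + 1)\<close>. The cap at \<open>t\<close> keeps the approximation from
    looking beyond \<open>t\<close>.\<close>
  define p where "p n k = min t ((real k + 1) / (real n + 1))" for n k :: nat
  define \<kappa> where "\<kappa> n \<omega> = nat \<lfloor>(real n + 1) * \<tau> \<omega>\<rfloor>" for n \<omega>
  have [measurable]: "\<tau> \<in> borel_measurable G" by fact
  show "(\<lambda>\<omega>. Z (p n (\<kappa> n \<omega>)) \<omega>) \<in> borel_measurable G" for n
  proof (rule measurable_compose_countable)
    show "Z (p n k) \<in> borel_measurable G" for k
      using t by (intro Z) (auto simp: p_def)
    show "\<kappa> n \<in> measurable G (count_space UNIV)"
      unfolding \<kappa>_def by measurable
  qed
  fix \<omega> assume \<omega>: "\<omega> \<in> space G"
  let ?s = "\<tau> \<omega>"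
  have s: "0 \<le> ?s" "?s \<le> t" using \<tau> \<omega> by auto
  have up: "?s \<le> p n (\<kappa> n \<omega>)" and down: "p n (\<kappa> n \<omega>) \<le> ?s + 1 / (real n + 1)" for n
  proof -
    have "real (\<kappa> n \<omega>) = of_int \<lfloor>(real n + 1) * ?s\<rfloor>"
      using s by (simp add: \<kappa>_def)
    then have "(real n + 1) * ?s \<le> real (\<kappa> n \<omega>) + 1" "real (\<kappa> n \<omega>) \<le> (real n + 1) * ?s"
      by linarith+
    then have "?s \<le> (real (\<kappa> n \<omega>) + 1) / (real n + 1)"
      "(real (\<kappa> n \<omega>) + 1) / (real n + 1) \<le> ((real n + 1) * ?s + 1) / (real n + 1)"
      by (simp_all add: pos_le_divide_eq mult.commute divide_right_mono)
    moreover have "((real n + 1) * ?s + 1) / (real n + 1) = ?s + 1 / (real n + 1)"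
      by (simp add: add_divide_distrib)
    ultimately show "?s \<le> p n (\<kappa> n \<omega>)" "p n (\<kappa> n \<omega>) \<le> ?s + 1 / (real n + 1)"
      using s by (auto simp: p_def)
  qed
  have upper: "(\<lambda>n. ?s + 1 / (real n + 1)) \<longlonglongrightarrow> ?s"
  proof -
    have "(\<lambda>n. ?s + 1 / (real n + 1)) \<longlonglongrightarrow> ?s + 0"
      using LIMSEQ_inverse_real_of_nat
      by (intro tendsto_add tendsto_const) (simp add: inverse_eq_divide add.commute)
    then show ?thesis by simp
  qed
  have lim: "(\<lambda>n. p n (\<kappa> n \<omega>)) \<longlonglongrightarrow> ?s"
    by (rule tendsto_sandwich[OF _ _ tendsto_const upper]) (use up down in auto)
  \<comment> \<open>Because of the cap, the approximating times equal \<open>?s\<close> when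
    \<open>?s = t\<close>. The limit is therefore taken along \<open>{?s..}\<close>, which includes
    the point itself.\<close>
  have "{?s..} - {?s} = {?s<..} - {?s}" by auto
  then have "at ?s within {?s..} = at_right ?s"
    by (simp add: at_within_def)
  with right[OF \<omega> s(1)] have "continuous (at ?s within {?s..}) (\<lambda>s. Z s \<omega>)"
    by (simp add: continuous_within)
  then show "(\<lambda>n. Z (p n (\<kappa> n \<omega>)) \<omega>) \<longlonglongrightarrow> Z ?s \<omega>"
    using continuous_within_tendsto_compose'[of ?s "{?s..}" "\<lambda>s. Z s \<omega>" "\<lambda>n. p n (\<kappa> n \<omega>)"] up lim
    by auto
qed

text \<open>\<open>G\<close> stands for the information at time \<open>t\<close> and is kept general
  to serve both the given and the generated filtration. The arrival times are recovered from
  \<open>N\<close> on \<open>[0, t]\<close>.\<close>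

lemma measurable_hybrid_solution:
  fixes X Y :: "real \<Rightarrow> 'a \<Rightarrow> real" and N :: "real \<Rightarrow> 'a \<Rightarrow> nat" and T :: "nat \<Rightarrow> 'a \<Rightarrow> real"
  assumes paths: "\<And>\<omega>. \<omega> \<in> space G \<Longrightarrow>
      hybrid_paths (\<lambda>i. T i \<omega>) (\<lambda>t. N t \<omega>) (\<lambda>t. X t \<omega>) (\<lambda>t. Y t \<omega>)"
    and X: "\<And>s. 0 \<le> s \<Longrightarrow> s \<le> t \<Longrightarrow> X s \<in> borel_measurable G"
    and Y: "\<And>s. 0 \<le> s \<Longrightarrow> s \<le> t \<Longrightarrow> Y s \<in> borel_measurable G"
    and N: "\<And>s. 0 \<le> s \<Longrightarrow> s \<le> t \<Longrightarrow> N s \<in> measurable G (count_space UNIV)"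
    and t: "0 \<le> t"
  shows "(\<lambda>\<omega>. hybrid_paths.U (\<lambda>i. T i \<omega>) (\<lambda>t. N t \<omega>) (\<lambda>t. X t \<omega>) (\<lambda>t. Y t \<omega>) b x t)
    \<in> borel_measurable G"
proof -
  \<comment> \<open>For \<open>0 \<le> s < t\<close> the event that the \<open>i\<close>-th arrival
    has occurred by \<open>s\<close> is \<open>i \<le> N s\<close>; for other \<open>s\<close> the
    event is trivial.\<close>
  have T: "(\<lambda>\<omega>. min t (T i \<omega>)) \<in> borel_measurable G" for i
    unfolding borel_measurable_iff_le
  proof
    fix s
    consider "t \<le> s" | "s < 0" | "0 \<le> s" "s < t" by linarith
    then show "{\<omega> \<in> space G. min t (T i \<omega>) \<le> s} \<in> sets G"
    proof cases
      case 1
      then have "{\<omega> \<in> space G. min t (T i \<omega>) \<le> s} = space G" by auto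
      then show ?thesis by simp
    next
      case 2
      have "{\<omega> \<in> space G. min t (T i \<omega>) \<le> s} = {}"
        using 2 t hybrid_paths.T_nonneg[OF paths, of _ i] by (force simp: min_le_iff_disj)
      then show ?thesis by (simp only: sets.empty_sets)
    next
      case 3
      then have "{\<omega> \<in> space G. min t (T i \<omega>) \<le> s} = N s -` {i..} \<inter> space G"
        using hybrid_paths.T_le_iff[OF paths, of _ s i] by (auto simp: min_le_iff_disj)
      also have "\<dots> \<in> sets G"
        using N[of s] 3 by (intro measurable_sets[of _ _ "count_space UNIV"]) auto
      finally show ?thesis .
    qed
  qed
  have at_T: "(\<lambda>\<omega>. Z (min t (T i \<omega>)) \<omega>) \<in> borel_measurable G"
    if "\<And>s. 0 \<le> s \<Longrightarrow> s \<le> t \<Longrightarrow> Z s \<in> borel_measurable G" "\<And>\<omega>. \<omega> \<in> space G \<Longrightarrow> cadlag (\<lambda>s. Z s \<omega>)"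
    for Z :: "real \<Rightarrow> 'a \<Rightarrow> real" and i
  proof (rule measurable_at_random_time[where Z = Z and t = t and \<tau> = "\<lambda>\<omega>. min t (T i \<omega>)"])
    show "((\<lambda>s. Z s \<omega>) \<longlongrightarrow> Z s \<omega>) (at_right s)" if "\<omega> \<in> space G" "0 \<le> s" for \<omega> s
      using \<open>\<And>\<omega>. \<omega> \<in> space G \<Longrightarrow> cadlag (\<lambda>s. Z s \<omega>)\<close>[OF that(1)] that(2) by (rule cadlag_right)
    show "0 \<le> min t (T i \<omega>)" if "\<omega> \<in> space G" for \<omega>
      using hybrid_paths.T_nonneg[OF paths[OF that], of i] t by simp
  qed (use that(1) T t in simp_all)
  have [measurable]: "(\<lambda>\<omega>. X (min t (T i \<omega>)) \<omega>) \<in> borel_measurable G"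
    "(\<lambda>\<omega>. Y (min t (T i \<omega>)) \<omega>) \<in> borel_measurable G" for i
    using at_T[OF X hybrid_paths.cadlag_X[OF paths]] at_T[OF Y hybrid_paths.cadlag_Y[OF paths]]
    by auto
  have V: "(\<lambda>\<omega>. hybrid_rec b x (\<lambda>i. T i \<omega>) (\<lambda>t. X t \<omega>) (\<lambda>t. Y t \<omega>) n t) \<in> borel_measurable G" for n
  proof (induction n)
    case (Suc n)
    note [measurable] = Suc
    show ?case unfolding hybrid_rec.simps by measurable
  qed simp
  have [measurable]: "N t \<in> measurable G (count_space UNIV)"
    using N t by simp
  \<comment> \<open>The number of stages is random but takes only countably many values.\<close>
  have "(\<lambda>\<omega>. hybrid_rec b x (\<lambda>i. T i \<omega>) (\<lambda>t. X t \<omega>) (\<lambda>t. Y t \<omega>) (Suc (N t \<omega>)) t)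
      \<in> borel_measurable G"
    by (rule measurable_compose_countable[OF V]) measurable
  then show ?thesis
    by (rule measurable_cong[THEN iffD1, rotated]) (simp add: hybrid_paths.U_def[OF paths])
qed

section \<open>Arrival times of a Poisson process\<close>

context prob_space
begin

text \<open>By independence, \<open>n\<close> consecutive gaps are all at most 1 with probability
  \<open>q ^ n\<close>, where \<open>q < 1\<close>. Hence almost surely no tail of the sequence
  stays below or at 1, which rules out accumulation of arrivals.\<close>

lemma AE_frequently_large_gaps:
  fixes \<xi> :: "nat \<Rightarrow> 'a \<Rightarrow> real"
  assumes indep: "indep_vars (\<lambda>_. borel) \<xi> {1..}"
    and exp: "\<And>k. 1 \<le> k \<Longrightarrow> distributed M lborel (\<xi> k) (exponential_density rate)"
    and rate: "0 < rate"
  shows "AE \<omega> in M. \<forall>m. \<exists>k\<ge>m. 1 < \<xi> k \<omega>"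
  unfolding AE_all_countable
proof
  fix m :: nat
  \<comment> \<open>The gaps are indexed from 1, so the shift keeps the indices admissible also for
    \<open>m = 0\<close>.\<close>
  let ?m = "Suc m"
  define q where "q = 1 - exp (- rate)"
  have q: "0 \<le> q" "q < 1" using rate by (auto simp: q_def)
  have [measurable]: "\<xi> k \<in> borel_measurable M" if "1 \<le> k" for k
    using distributed_measurable[OF exp[OF that]] by simp
  have meas[measurable]: "{\<omega> \<in> space M. \<xi> (?m + k) \<omega> \<le> 1} \<in> sets M" for k
    by measurable
  let ?A = "{\<omega> \<in> space M. \<forall>k. \<xi> (?m + k) \<omega> \<le> 1}"
  \<comment> \<open>\<open>n\<close> is positive so that the intersection and the product rule
    concern a nonempty index set; the limit is unaffected.\<close>
  have le: "prob ?A \<le> q ^ n" if "0 < n" for n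
  proof -
    have "prob ?A \<le> prob (\<Inter>k\<in>{?m..<?m + n}. \<xi> k -` {..1} \<inter> space M)"
    proof (rule finite_measure_mono)
      show "?A \<subseteq> (\<Inter>k\<in>{?m..<?m + n}. \<xi> k -` {..1} \<inter> space M)"
        by (auto simp: le_iff_add)
      show "(\<Inter>k\<in>{?m..<?m + n}. \<xi> k -` {..1} \<inter> space M) \<in> events"
        using that by (intro sets.finite_INT) auto
    qed
    also have "\<dots> = (\<Prod>k\<in>{?m..<?m + n}. prob (\<xi> k -` {..1} \<inter> space M))"
      using that by (intro indep_varsD[OF indep]) auto
    also have "\<dots> = (\<Prod>k\<in>{?m..<?m + n}. q)"
    proof (rule prod.cong)
      fix k assume "k \<in> {?m..<?m + n}"
      then have "\<P>(\<omega> in M. \<xi> k \<omega> \<le> 1) = q"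
        using exponential_distributedD_le[OF exp, of k 1] rate by (simp add: q_def)
      moreover have "\<xi> k -` {..1} \<inter> space M = {\<omega> \<in> space M. \<xi> k \<omega> \<le> 1}" by auto
      ultimately show "prob (\<xi> k -` {..1} \<inter> space M) = q" by simp
    qed simp
    finally show ?thesis by simp
  qed
  have "prob ?A \<le> 0"
  proof (rule LIMSEQ_le_const)
    show "(\<lambda>n. q ^ n) \<longlonglongrightarrow> 0" using q by (intro LIMSEQ_realpow_zero)
    show "\<exists>n0. \<forall>n\<ge>n0. prob ?A \<le> q ^ n" by (intro exI[of _ 1] allI impI le) simp
  qed
  then have "prob ?A = 0" by (simp add: measure_le_0_iff)
  then have "AE \<omega> in M. \<omega> \<notin> ?A"
    by (subst (asm) prob_eq_0) auto
  then show "AE \<omega> in M. \<exists>k\<ge>m. 1 < \<xi> k \<omega>"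
    using AE_space
  proof eventually_elim
    case (elim \<omega>)
    then obtain k where "1 < \<xi> (?m + k) \<omega>" by (auto simp: not_le)
    then show ?case by (intro exI[of _ "?m + k"]) auto
  qed
qed

lemma AE_exponential_pos:
  assumes exp: "distributed M lborel Z (exponential_density rate)" and rate: "0 < rate"
  shows "AE \<omega> in M. 0 < (Z \<omega> :: real)"
proof -
  have [measurable]: "Z \<in> borel_measurable M"
    using distributed_measurable[OF exp] by simp
  show ?thesis
    using exponential_distributedD_gt[OF exp _ rate, of 0] prob_eq_1[of "{\<omega> \<in> space M. 0 < Z \<omega>}"]
    by auto
qed

end

section \<open>Pathwise properties of the arrival times\<close>

lemma strict_mono_arrival_time:
  assumes "\<And>k. 1 \<le> k \<Longrightarrow> 0 < \<xi> k \<omega>"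
  shows "strict_mono (\<lambda>i. arrival_time \<xi> i \<omega>)"
  unfolding strict_mono_Suc_iff using assms by (simp add: arrival_time_def)

text \<open>Each gap longer than 1 raises the arrival time by more than 1, and beyond any index
  there is another such gap.\<close>

lemma arrival_time_unbounded:
  assumes pos: "\<And>k. 1 \<le> k \<Longrightarrow> 0 < \<xi> k \<omega>" and large: "\<forall>m. \<exists>k\<ge>m. 1 < \<xi> k \<omega>"
  shows "\<exists>n. t < arrival_time \<xi> n \<omega>"
proof -
  have mono: "mono (\<lambda>i. arrival_time \<xi> i \<omega>)"
    using pos by (intro strict_mono_mono strict_mono_arrival_time)
  have "\<exists>n. real K \<le> arrival_time \<xi> n \<omega>" for K :: nat
  proof (induction K)
    case 0
    show ?case by (rule exI[of _ 0]) (simp add: arrival_time_def)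
  next
    case (Suc K)
    then obtain n where n: "real K \<le> arrival_time \<xi> n \<omega>" by blast
    from large obtain k where k: "Suc n \<le> k" "1 < \<xi> k \<omega>" by blast
    then obtain j where j: "k = Suc j" "n \<le> j" by (cases k) auto
    have "arrival_time \<xi> n \<omega> \<le> arrival_time \<xi> j \<omega>"
      using monoD[OF mono j(2)] .
    with n k j have "real (Suc K) \<le> arrival_time \<xi> k \<omega>"
      by (simp add: arrival_time_def)
    then show ?case ..
  qed
  moreover obtain K :: nat where "t < real K" using reals_Archimedean2 by blast
  ultimately show ?thesis by (meson less_le_trans)
qed

lemma arrival_time_le_iff:
  assumes pos: "\<And>k. 1 \<le> k \<Longrightarrow> 0 < \<xi> k \<omega>" and large: "\<forall>m. \<exists>k\<ge>m. 1 < \<xi> k \<omega>"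
    and t: "0 \<le> t"
  shows "arrival_time \<xi> i \<omega> \<le> t \<longleftrightarrow> i \<le> card {i. 1 \<le> i \<and> arrival_time \<xi> i \<omega> \<le> t}"
proof -
  let ?T = "\<lambda>i. arrival_time \<xi> i \<omega>"
  have strict: "strict_mono ?T"
    using pos by (rule strict_mono_arrival_time)
  \<comment> \<open>\<open>m\<close> is the index of the first arrival after \<open>t\<close>; it
    exists by unboundedness, and monotonicity makes the indices below it exactly those up to time
    \<open>t\<close>.\<close>
  define m where "m = (LEAST n. t < ?T n)"
  have m: "t < ?T m"
    unfolding m_def using arrival_time_unbounded[of \<xi> \<omega>, OF pos large] by (rule LeastI_ex)
  have iff: "?T i \<le> t \<longleftrightarrow> i < m" for i
  proof
    assume "?T i \<le> t"
    with m have "?T i < ?T m" by simp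
    then show "i < m" by (simp add: strict_mono_less[OF strict])
  next
    assume "i < m"
    then show "?T i \<le> t"
      unfolding m_def by (meson not_less_Least not_le)
  qed
  have "0 < m"
    using iff[of 0] t by (simp add: arrival_time_def)
  \<comment> \<open>The starting time \<open>T 0 = 0\<close> is not counted as an arrival, so the
    count is \<open>m - 1\<close> and not \<open>m\<close>.\<close>
  moreover have "{i. 1 \<le> i \<and> ?T i \<le> t} = {1..<m}"
    by (auto simp: iff)
  ultimately have "card {i. 1 \<le> i \<and> ?T i \<le> t} = m - 1"
    by simp
  with \<open>0 < m\<close> iff[of i] show ?thesis by auto
qed

lemma AE_hybrid_paths:
  assumes M: "prob_space M" and X: "levy_process M X" and Y: "levy_process M Y"
    and rate: "0 < rate" and N: "poisson_process M rate \<xi> N"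
  shows "AE \<omega> in M. hybrid_paths (\<lambda>i. arrival_time \<xi> i \<omega>) (\<lambda>t. N t \<omega>) (\<lambda>t. X t \<omega>) (\<lambda>t. Y t \<omega>)"
proof -
  interpret prob_space M by fact
  have exp: "distributed M lborel (\<xi> k) (exponential_density rate)" if "1 \<le> k" for k
    using N that by (simp add: poisson_process_def)
  have "AE \<omega> in M. \<forall>k. 1 \<le> k \<longrightarrow> 0 < \<xi> k \<omega>"
    unfolding AE_all_countable using AE_exponential_pos[OF exp rate] by (intro allI AE_impI) auto
  moreover have "AE \<omega> in M. \<forall>m. \<exists>k\<ge>m. 1 < \<xi> k \<omega>"
    using N rate by (intro AE_frequently_large_gaps[OF _ exp]) (auto simp: poisson_process_def)
  moreover have "AE \<omega> in M. \<forall>t\<ge>0. N t \<omega> = card {i. 1 \<le> i \<and> arrival_time \<xi> i \<omega> \<le> t}"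
    using N by (simp add: poisson_process_def)
  moreover have "AE \<omega> in M. cadlag (\<lambda>t. X t \<omega>)" "AE \<omega> in M. cadlag (\<lambda>t. Y t \<omega>)"
    using X Y by (simp_all add: levy_process_def)
  ultimately show ?thesis
  proof eventually_elim
    case (elim \<omega>)
    then have pos: "\<And>k. 1 \<le> k \<Longrightarrow> 0 < \<xi> k \<omega>" by blast
    show ?case
    proof
      show "arrival_time \<xi> 0 \<omega> = 0" by (simp add: arrival_time_def)
      show "strict_mono (\<lambda>i. arrival_time \<xi> i \<omega>)"
        using pos by (rule strict_mono_arrival_time)
      show "arrival_time \<xi> i \<omega> \<le> t \<longleftrightarrow> i \<le> N t \<omega>" if "0 \<le> t" for t i
      proof -
        have "N t \<omega> = card {i. 1 \<le> i \<and> arrival_time \<xi> i \<omega> \<le> t}"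
          using elim(3) that by blast
        then show ?thesis
          using arrival_time_le_iff[of \<xi> \<omega>, OF pos elim(2) that, of i] by (rule ssubst)
      qed
    qed (fact elim)+
  qed
qed

text \<open>Substitute drivers for the exceptional null event: with them the constructed path is
  cadlag at every point of the space, as a strong solution requires, and not only almost
  surely.\<close>

lemma hybrid_paths_deterministic:
  "hybrid_paths real (\<lambda>t. nat \<lfloor>t\<rfloor>) (\<lambda>_. 0) (\<lambda>_. 0)"
proof
  show "real i \<le> t \<longleftrightarrow> i \<le> nat \<lfloor>t\<rfloor>" if "0 \<le> t" for t i
    using that by (simp add: le_nat_iff le_floor_iff)
qed (auto simp: strict_mono_def cadlag_const)

section \<open>The strong solution\<close>

lemma measurable_path_events:
  assumes "path_events M S Z I \<subseteq> sets G" "space G = space M" "space S = UNIV" "t \<in> I"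
  shows "Z t \<in> measurable G S"
proof (rule measurableI)
  fix A assume "A \<in> sets S"
  with assms(4) have "Z t -` A \<inter> space M \<in> path_events M S Z I"
    by (auto simp: path_events_def)
  with assms(1,2) show "Z t -` A \<inter> space G \<in> sets G" by auto
qed (simp add: assms(3))

lemma driving_filtration:
  shows space_driving_filtration: "space (driving_filtration M X Y N t) = space M"
    and sets_driving_filtration: "sets (driving_filtration M X Y N t) =
      sigma_sets (space M) (path_events M borel X {0..t} \<union> path_events M borel Y {0..t} \<union>
        path_events M (count_space UNIV) N {0..t} \<union> null_sets M)"
proof -
  have "path_events M borel X {0..t} \<union> path_events M borel Y {0..t} \<union>
        path_events M (count_space UNIV) N {0..t} \<union> null_sets M \<subseteq> Pow (space M)"
    by (auto simp: path_events_def dest: null_setsD2 sets.sets_into_space)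
  then show "space (driving_filtration M X Y N t) = space M"
    "sets (driving_filtration M X Y N t) =
      sigma_sets (space M) (path_events M borel X {0..t} \<union> path_events M borel Y {0..t} \<union>
        path_events M (count_space UNIV) N {0..t} \<union> null_sets M)"
    by (simp_all add: driving_filtration_def)
qed

lemma measurable_driving_filtration:
  assumes "0 \<le> s" "s \<le> t"
  shows "X s \<in> borel_measurable (driving_filtration M X Y N t)"
    and "Y s \<in> borel_measurable (driving_filtration M X Y N t)"
    and "N s \<in> measurable (driving_filtration M X Y N t) (count_space UNIV)"
proof -
  have "path_events M borel X {0..t} \<subseteq> sets (driving_filtration M X Y N t)"
    "path_events M borel Y {0..t} \<subseteq> sets (driving_filtration M X Y N t)"
    "path_events M (count_space UNIV) N {0..t} \<subseteq> sets (driving_filtration M X Y N t)"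
    unfolding sets_driving_filtration by (blast intro: sigma_sets.Basic)+
  from this[THEN measurable_path_events, OF space_driving_filtration, of s] assms
  show "X s \<in> borel_measurable (driving_filtration M X Y N t)"
    "Y s \<in> borel_measurable (driving_filtration M X Y N t)"
    "N s \<in> measurable (driving_filtration M X Y N t) (count_space UNIV)"
    by simp_all
qed

theorem theorem1:
  fixes M :: "'a measure" and F :: "real \<Rightarrow> 'a measure"
    and X Y :: "real \<Rightarrow> 'a \<Rightarrow> real" and N :: "real \<Rightarrow> 'a \<Rightarrow> nat"
    and \<xi> :: "nat \<Rightarrow> 'a \<Rightarrow> real" and rate b x :: real
  assumes "filtered_prob_space M F"
    and "spectrally_negative_levy M X" and "adapted F borel X"
    and "spectrally_negative_levy M Y" and "adapted F borel Y"
    and "0 < rate" and "poisson_process M rate \<xi> N" and "adapted F (count_space UNIV) N"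
    and "independent_drivers M X Y N"
  shows "\<exists>U. strong_solution M F b \<xi> N X Y x U"
proof -
  interpret prob_space M
    using assms(1) by (simp add: filtered_prob_space_def)
  interpret filtration "space M" F
    using assms(1) by (simp add: filtered_prob_space_def)
  let ?paths = "\<lambda>\<omega>. hybrid_paths (\<lambda>i. arrival_time \<xi> i \<omega>) (\<lambda>t. N t \<omega>) (\<lambda>t. X t \<omega>) (\<lambda>t. Y t \<omega>)"
  have AE_paths: "AE \<omega> in M. ?paths \<omega>"
    using assms prob_space_axioms by (intro AE_hybrid_paths) (auto simp: spectrally_negative_levy_def)
  \<comment> \<open>The set of bad paths need not be measurable, so it is enclosed in a null event
    \<open>B\<close>. The null events belong to both filtrations at every time
    \<open>t \<ge> 0\<close>, so modifying the drivers on \<open>B\<close> keeps them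
    adapted.\<close>
  then obtain B where B: "{\<omega> \<in> space M. \<not> ?paths \<omega>} \<subseteq> B" "B \<in> null_sets M"
    by (auto elim!: AE_E)
  define X' where "X' t \<omega> = (if \<omega> \<in> B then 0 else X t \<omega>)" for t \<omega>
  define Y' where "Y' t \<omega> = (if \<omega> \<in> B then 0 else Y t \<omega>)" for t \<omega>
  define N' where "N' t \<omega> = (if \<omega> \<in> B then nat \<lfloor>t\<rfloor> else N t \<omega>)" for t \<omega>
  define T where "T i \<omega> = (if \<omega> \<in> B then real i else arrival_time \<xi> i \<omega>)" for i \<omega>
  define U where "U t \<omega> =
    hybrid_paths.U (\<lambda>i. T i \<omega>) (\<lambda>t. N' t \<omega>) (\<lambda>t. X' t \<omega>) (\<lambda>t. Y' t \<omega>) b x t" for t \<omega>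
  have paths: "hybrid_paths (\<lambda>i. T i \<omega>) (\<lambda>t. N' t \<omega>) (\<lambda>t. X' t \<omega>) (\<lambda>t. Y' t \<omega>)"
    if "\<omega> \<in> space M" for \<omega>
    using B(1) that hybrid_paths_deterministic
    by (cases "\<omega> \<in> B") (auto simp: X'_def Y'_def N'_def T_def)
  have U_measurable: "U t \<in> borel_measurable G"
    if t: "0 \<le> t" and G: "space G = space M" "null_sets M \<subseteq> sets G"
      and XYN: "\<And>s. 0 \<le> s \<Longrightarrow> s \<le> t \<Longrightarrow> X s \<in> borel_measurable G"
        "\<And>s. 0 \<le> s \<Longrightarrow> s \<le> t \<Longrightarrow> Y s \<in> borel_measurable G"
        "\<And>s. 0 \<le> s \<Longrightarrow> s \<le> t \<Longrightarrow> N s \<in> measurable G (count_space UNIV)"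
    for t and G :: "'a measure"
    unfolding U_def
  proof (rule measurable_hybrid_solution)
    have [measurable]: "B \<in> sets G" using B G by auto
    fix s assume s: "0 \<le> s" "s \<le> t"
    note [measurable] = XYN[OF s]
    show "X' s \<in> borel_measurable G" unfolding X'_def by measurable
    show "Y' s \<in> borel_measurable G" unfolding Y'_def by measurable
    show "N' s \<in> measurable G (count_space UNIV)" unfolding N'_def by measurable
  qed (use paths t G in auto)
  have "strong_solution M F b \<xi> N X Y x U"
    unfolding strong_solution_def
  proof (intro conjI ballI)
    show "cadlag (\<lambda>t. U t \<omega>)" if "\<omega> \<in> space M" for \<omega>
      using hybrid_paths.cadlag_U[OF paths[OF that]] by (simp add: U_def)
    show "adapted F borel U"
      unfolding adapted_def
    proof (intro allI impI U_measurable)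
      fix t :: real assume t: "0 \<le> t"
      have "null_sets M \<subseteq> sets (F 0)"
        using assms(1) by (simp add: filtered_prob_space_def usual_conditions_def)
      also have "\<dots> \<subseteq> sets (F t)" using t by (rule sets_F_mono)
      finally show "null_sets M \<subseteq> sets (F t)" .
      \<comment> \<open>Measurability at time \<open>t\<close> draws on the drivers at all earlier
        times. The target space is general so as to cover real-valued \<open>X\<close>,
        \<open>Y\<close> and integer-valued \<open>N\<close>.\<close>
      have mono: "Z \<in> measurable (F t) S" if "Z \<in> measurable (F s) S" "s \<le> t"
        for Z and S :: "'b measure" and s
        using that sets_F_mono[of s t] space_F measurable_mono[of S S "F s" "F t"] by auto
      show "X s \<in> borel_measurable (F t)" if "0 \<le> s" "s \<le> t" for s
        using assms(3) that by (auto simp: adapted_def intro: mono)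
      show "Y s \<in> borel_measurable (F t)" if "0 \<le> s" "s \<le> t" for s
        using assms(5) that by (auto simp: adapted_def intro: mono)
      show "N s \<in> measurable (F t) (count_space UNIV)" if "0 \<le> s" "s \<le> t" for s
        using assms(8) that by (auto simp: adapted_def intro: mono)
    qed (simp_all add: space_F)
    show "adapted (driving_filtration M X Y N) borel U"
      unfolding adapted_def
      by (intro allI impI U_measurable measurable_driving_filtration)
        (auto simp: space_driving_filtration sets_driving_filtration intro: sigma_sets.Basic)
    have B_AE: "AE \<omega> in M. \<omega> \<in> space M - B"
      using AE_not_in[OF B(2)] AE_space by eventually_elim auto
    show "AE \<omega> in M. U 0 \<omega> = x"
      using AE_space by eventually_elim (simp add: U_def hybrid_paths.U_0[OF paths])
    show "AE \<omega> in M. hybrid_equation b (\<lambda>i. arrival_time \<xi> i \<omega>) (\<lambda>t. N t \<omega>)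
        (\<lambda>t. X t \<omega>) (\<lambda>t. Y t \<omega>) (\<lambda>t. U t \<omega>)"
      using B_AE
    proof eventually_elim
      case (elim \<omega>)
      \<comment> \<open>Off \<open>B\<close> the substitute drivers and arrival times are the
        original ones, so the pathwise equation is the required one.\<close>
      then show ?case
        using hybrid_paths.hybrid_equation_U[OF paths, of \<omega> b x]
        by (simp add: U_def T_def X'_def Y'_def N'_def)
    qed
  qed
  then show ?thesis by blast
qed

end
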